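(* Let $D$ be a finitely connected planar domain and let $E$ be a connected component of $\overline{\mathbb{C}}\setminus D$. (1) If $E$ is not a single point, then $$\lim_{D\ni z\rightarrow E}s_D(z)=1.$$ (2) If $E = \{p\}$ is a single point, then $$s_D(z)\leq \sigma^{-1}(K_{\tilde{D}}(z ,p)),\qquad z\in D,$$ where $\tilde{D}:= D\cup\{p\}$. In particular, $$\lim_{D\ni z\rightarrow p}s_D(z)=0.$$
   Context: $\overline{\mathbb{C}}$ is the Riemann sphere; a planar domain $D\subset\mathbb{C}$ is finitely connected if $\overline{\mathbb{C}}\setminus D$ has finitely many connected components. $\Delta$ is the open unit disc and $\Delta_r$ the open disc with center $0$ and radius $r$. The squeezing function of $D$ is $s_D(p)=\sup_f\,\sup\{r:\Delta_r\subset f(D)\}$, where the outer supremum is over all injective holomorphic maps $f:D\to\Delta$ with $f(p)=0$ (and $s_D\equiv 0$ if no such map exists). $\sigma(c)=\log\frac{1+c}{1-c}$ for $c\in[0,1)$, with inverse $\sigma^{-1}(w)=\tanh(w/2)$. $K_{\tilde D}(\cdot,\cdot)$ is the Kobayashi (pseudo)distance on $\tilde D$, normalized so that on $\Delta$ it is the Poincaré distance with $K_\Delta(0,z)=\sigma(|z|)$. *)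

theory Defs
  imports "HOL-Complex_Analysis.Complex_Analysis"
begin

text \<open>The Riemann sphere is the one-point compactification of the plane: \<open>None\<close> is the point at
  infinity and \<open>Some z\<close> the finite point \<open>z\<close>.\<close>

definition riemann_sphere :: "complex option topology" where
  "riemann_sphere = Alexandroff_compactification euclidean"

definition complement_components :: "complex set \<Rightarrow> complex option set set" where
  "complement_components D =
     connected_components_of (subtopology riemann_sphere (topspace riemann_sphere - Some ` D))"

definition planar_domain :: "complex set \<Rightarrow> bool" where
  "planar_domain D \<longleftrightarrow> open D \<and> connected D \<and> D \<noteq> {}"

definition finitely_connected :: "complex set \<Rightarrow> bool" where
  "finitely_connected D \<longleftrightarrow> finite (complement_components D)"

text \<open>The filter describing \<open>D \<ni> z \<longrightarrow> E\<close>. For compact \<open>E\<close> (such as a component of the complement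
  of \<open>D\<close>) this says that the spherical distance from \<open>z\<close> to \<open>E\<close> tends to 0.\<close>

definition tending_to :: "complex set \<Rightarrow> complex option set \<Rightarrow> complex filter" where
  "tending_to D E =
     (INF U\<in>{U. openin riemann_sphere U \<and> E \<subseteq> U}. principal {z\<in>D. Some z \<in> U})"

definition disc_embeddings :: "complex set \<Rightarrow> complex \<Rightarrow> (complex \<Rightarrow> complex) set" where
  "disc_embeddings D p =
     {f. f holomorphic_on D \<and> inj_on f D \<and> f ` D \<subseteq> ball 0 1 \<and> f p = 0}"

definition squeezing_function :: "complex set \<Rightarrow> complex \<Rightarrow> real" where
  "squeezing_function D p =
     (if disc_embeddings D p = {} then 0
      else SUP f\<in>disc_embeddings D p. Sup {r. 0 < r \<and> ball 0 r \<subseteq> f ` D})"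

definition sigma :: "real \<Rightarrow> real" where
  "sigma c = ln ((1 + c) / (1 - c))"

definition sigma_inv :: "real \<Rightarrow> real" where
  "sigma_inv w = tanh (w / 2)"

lemma sigma_inv_sigma:
  assumes "0 \<le> c" "c < 1"
  shows "sigma_inv (sigma c) = c"
proof -
  have "exp (- sigma c) = (1 - c) / (1 + c)"
    using assms by (simp add: sigma_def exp_minus)
  then have "sigma_inv (sigma c) = (1 - (1 - c) / (1 + c)) / (1 + (1 - c) / (1 + c))"
    by (simp add: sigma_inv_def tanh_real_altdef)
  also have "\<dots> = c"
    using assms by (simp add: divide_simps)
  finally show ?thesis .
qed

definition poincare_dist :: "complex \<Rightarrow> complex \<Rightarrow> real" where
  "poincare_dist a b = sigma (cmod ((a - b) / (1 - cnj b * a)))"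

text \<open>The chart \<open>w = 1 / z\<close> of the sphere at infinity, read as a map from the plane to the sphere.\<close>

definition chart_at_infinity :: "complex \<Rightarrow> complex option" where
  "chart_at_infinity w = (if w = 0 then None else Some (1 / w))"

definition sphere_holomorphic_on :: "(complex \<Rightarrow> complex option) \<Rightarrow> complex set \<Rightarrow> bool" where
  "sphere_holomorphic_on f S \<longleftrightarrow>
     (\<forall>z\<in>S. \<exists>U g. open U \<and> z \<in> U \<and> U \<subseteq> S \<and> g holomorphic_on U \<and>
        ((\<forall>w\<in>U. f w = Some (g w)) \<or> (\<forall>w\<in>U. f w = chart_at_infinity (g w))))"

text \<open>The Kobayashi pseudodistance of a domain \<open>X\<close> in the sphere: the infimum of the Poincare lengths
  of chains of holomorphic discs from \<open>p\<close> to \<open>q\<close>. Such chains exist since \<open>X\<close> is connected, so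
  the real infimum is genuine.\<close>

definition kobayashi_dist ::
    "complex option set \<Rightarrow> complex option \<Rightarrow> complex option \<Rightarrow> real" where
  "kobayashi_dist X p q =
     Inf {(\<Sum>i<n. poincare_dist (a i) (b i)) | (n::nat) x f a b.
            x 0 = p \<and> x n = q \<and>
            (\<forall>i<n. sphere_holomorphic_on (f i) (ball 0 1) \<and> f i ` ball 0 1 \<subseteq> X \<and>
                   a i \<in> ball 0 1 \<and> b i \<in> ball 0 1 \<and>
                   f i (a i) = x i \<and> f i (b i) = x (Suc i))}"

end

theory Submission
  imports Defs
begin

text \<open>If \<open>E\<close> contains a finite point \<open>a\<close> and a further point, the inversion \<open>w = 1 / (z - a)\<close> turns the
  complement of \<open>E\<close> into a simply connected proper subdomain of the plane, which a Riemann map takes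
  to the unit disc. So \<open>D\<close> becomes the disc minus a compact set, by finiteness of the number of
  components, and \<open>z \<rightarrow> E\<close> becomes convergence to the unit circle. Moving the image of \<open>z\<close> to the
  origin by a disc automorphism pushes the compact set towards the circle.

  If \<open>E = {p}\<close>, an injective \<open>f : D \<rightarrow> \<Delta>\<close> with \<open>f z = 0\<close> extends holomorphically over \<open>p\<close>, and the
  new value \<open>f p\<close> is omitted by \<open>f\<close> on \<open>D\<close>. Hence a disc around 0 inside \<open>f(D)\<close> has radius at most
  \<open>|f p|\<close>, and the Schwarz-Pick lemma along chains of discs gives \<open>\<sigma>(|f p|) \<le> K(z, p)\<close>.\<close>

subsection \<open>The Poincare distance and the squeezing function\<close>

lemma one_minus_cnj_mult_neq_0:
  fixes u v :: complex
  assumes "norm u < 1" "norm v < 1"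
  shows "1 - cnj v * u \<noteq> 0"
proof -
  have "norm (cnj v * u) < 1"
    using norm_mult_less[of "cnj v" 1 u 1] assms by simp
  then show ?thesis by auto
qed

lemma pseudo_hyperbolic_identity:
  fixes u v :: complex
  shows "(norm (1 - cnj v * u))\<^sup>2 - (norm (u - v))\<^sup>2 = (1 - (norm u)\<^sup>2) * (1 - (norm v)\<^sup>2)"
  by (simp add: cmod_power2) algebra

text \<open>By the identity above, \<open>A\<^sup>2 - B\<^sup>2\<close> and
  \<open>c\<^sup>2 - d\<^sup>2\<close> have the same value \<open>P \<ge> 0\<close>. The triangle
  inequality gives \<open>c \<le> A\<close>, and subtracting the same \<open>P\<close> costs
  relatively less from the larger square, so \<open>B / A\<close> dominates
  \<open>d / c\<close>.\<close>

lemma pseudo_hyperbolic_lower_bound: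
  fixes u v :: complex
  assumes "norm u < 1" "norm v < 1"
  shows "(norm v - norm u) / (1 - norm u * norm v) \<le> norm ((u - v) / (1 - cnj v * u))"
proof -
  define A B c d P where "A = norm (1 - cnj v * u)" and "B = norm (u - v)"
    and "c = 1 - norm u * norm v" and "d = norm v - norm u"
    and "P = (1 - (norm u)\<^sup>2) * (1 - (norm v)\<^sup>2)"
  have AB: "A\<^sup>2 - B\<^sup>2 = P"
    unfolding A_def B_def P_def by (rule pseudo_hyperbolic_identity)
  have cd: "c\<^sup>2 - d\<^sup>2 = P"
    by (simp add: c_def d_def P_def power2_eq_square algebra_simps)
  have "c > 0"
    using mult_strict_mono'[OF assms] by (simp add: c_def)
  have "A > 0"
    using one_minus_cnj_mult_neq_0[OF assms] by (simp add: A_def)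
  have "c \<le> A"
    using norm_triangle_ineq2[of 1 "cnj v * u"] by (simp add: A_def c_def norm_mult mult.commute)
  then have "c\<^sup>2 \<le> A\<^sup>2"
    using \<open>c > 0\<close> by (intro power_mono) auto
  moreover have "P \<ge> 0"
    using assms by (auto simp: P_def power_le_one intro!: mult_nonneg_nonneg)
  ultimately have "0 \<le> P * (A\<^sup>2 - c\<^sup>2)" by simp
  also have "\<dots> = (B * c)\<^sup>2 - (d * A)\<^sup>2"
  proof -
    have "B\<^sup>2 = A\<^sup>2 - P" "d\<^sup>2 = c\<^sup>2 - P" using AB cd by auto
    then show ?thesis by (simp only: power_mult_distrib) (simp add: algebra_simps)
  qed
  \<comment> \<open>Here \<open>d\<close> may be negative; comparing squares only requires
    \<open>B * c\<close> to be nonnegative.\<close>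
  finally have "d * A \<le> B * c"
    using \<open>c > 0\<close> by (auto intro: power2_le_imp_le simp: B_def)
  then have "d / c \<le> B / A"
    using \<open>c > 0\<close> \<open>A > 0\<close> by (simp add: divide_simps mult.commute)
  then show ?thesis
    by (simp add: A_def B_def c_def d_def norm_divide)
qed

lemma sigma_mono:
  assumes "-1 < c" "c \<le> d" "d < 1"
  shows "sigma c \<le> sigma d"
  unfolding sigma_def using assms by (subst ln_le_cancel_iff) (auto intro!: frac_le)

text \<open>Since \<open>sigma\<close> is twice the inverse hyperbolic tangent, this is the
  subtraction formula of that function.\<close>

lemma sigma_diff:
  assumes "\<bar>x\<bar> < 1" "\<bar>y\<bar> < 1"
  shows "sigma ((y - x) / (1 - x * y)) = sigma y - sigma x"
proof -
  have "x * y < 1"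
    using abs_mult_less[OF assms] by (simp flip: abs_mult)
  then have "(1 + (y - x) / (1 - x * y)) / (1 - (y - x) / (1 - x * y))
      = ((1 - x * y) + (y - x)) / ((1 - x * y) - (y - x))"
    by (simp add: divide_simps)
  also have "\<dots> = ((1 - x) * (1 + y)) / ((1 + x) * (1 - y))"
    by (simp add: algebra_simps)
  also have "\<dots> = ((1 + y) / (1 - y)) / ((1 + x) / (1 - x))"
    by (simp add: mult.commute)
  finally have eq: "(1 + (y - x) / (1 - x * y)) / (1 - (y - x) / (1 - x * y))
      = ((1 + y) / (1 - y)) / ((1 + x) / (1 - x))" .
  have "0 < (1 + y) / (1 - y)" "0 < (1 + x) / (1 - x)"
    using assms by auto
  then show ?thesis
    unfolding sigma_def eq by (subst ln_div) auto
qed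

lemma poincare_dist_Moebius: "poincare_dist a b = sigma (norm (Moebius_function 0 b a))"
  by (simp add: poincare_dist_def Moebius_function_simple)

lemma poincare_dist_nonneg:
  assumes "a \<in> ball 0 1" "b \<in> ball 0 1"
  shows "poincare_dist a b \<ge> 0"
  using sigma_mono[of 0 "norm (Moebius_function 0 b a)"] Moebius_function_norm_lt_1[of b a 0] assms
  by (auto simp: poincare_dist_Moebius) (simp add: sigma_def)

text \<open>The triangle inequality through the origin, because \<open>sigma (norm v)\<close> is the
  distance from 0 to \<open>v\<close>. Applying \<open>sigma\<close> to the lower bound for the
  pseudohyperbolic distance turns its left side into a difference by
  \<open>sigma_diff\<close>.\<close>

lemma sigma_norm_triangle:
  assumes "u \<in> ball 0 1" "v \<in> ball 0 1"
  shows "sigma (norm v) \<le> sigma (norm u) + poincare_dist u v"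
proof -
  have uv: "norm u < 1" "norm v < 1" using assms by auto
  have pos: "1 - norm u * norm v > 0"
    using mult_strict_mono'[OF uv] by simp
  \<comment> \<open>The quotient below is negative if \<open>norm v < norm u\<close>, while
    \<open>sigma_mono\<close> asks for arguments above -1. Clearing the denominator turns that
    condition into the positivity of this product.\<close>
  have "0 < (1 - norm u) * (1 + norm v)"
    using uv by (intro mult_pos_pos) (auto intro: add_pos_nonneg)
  then have "-1 < (norm v - norm u) / (1 - norm u * norm v)"
    using pos by (simp add: pos_less_divide_eq algebra_simps)
  then have "sigma ((norm v - norm u) / (1 - norm u * norm v)) \<le> poincare_dist u v"
    unfolding poincare_dist_def using pseudo_hyperbolic_lower_bound[OF uv]
      Moebius_function_norm_lt_1[of v u 0] uv
    by (intro sigma_mono) (auto simp: Moebius_function_simple)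
  then show ?thesis
    using sigma_diff[of "norm u" "norm v"] uv by simp
qed

text \<open>Disc automorphisms move \<open>b\<close> and \<open>h b\<close> to the origin; for the
  conjugated map \<open>k\<close> the claim is the Schwarz lemma at the point
  \<open>\<xi>\<close>.\<close>

lemma Schwarz_Pick:
  assumes "h holomorphic_on ball 0 1" "h ` ball 0 1 \<subseteq> ball 0 1" "a \<in> ball 0 1" "b \<in> ball 0 1"
  shows "poincare_dist (h a) (h b) \<le> poincare_dist a b"
proof -
  define k where "k = Moebius_function 0 (h b) \<circ> (h \<circ> Moebius_function 0 (- b))"
  define \<xi> where "\<xi> = Moebius_function 0 b a"
  have ab: "norm a < 1" "norm b < 1" using assms by auto
  have h: "norm (h z) < 1" if "norm z < 1" for z
    using assms(2) that by (auto simp: image_subset_iff)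
  have M: "norm (Moebius_function 0 w z) < 1" if "norm w < 1" "norm z < 1" for w z
    using that by (rule Moebius_function_norm_lt_1)
  have "k holomorphic_on ball 0 1"
    unfolding k_def using ab h M assms(1)
    by (intro holomorphic_on_compose_gen[of _ _ _ "ball 0 1"] Moebius_function_holomorphic) auto
  moreover have "k 0 = 0"
    by (simp add: k_def Moebius_function_simple)
  moreover have "norm (k z) < 1" if "norm z < 1" for z
    using that ab by (auto simp: k_def intro!: M h)
  moreover have \<xi>: "norm \<xi> < 1"
    using ab by (simp add: \<xi>_def M)
  ultimately have "norm (k \<xi>) \<le> norm \<xi>"
    by (rule Schwarz_Lemma)
  moreover have "Moebius_function 0 (- b) \<xi> = a"
    unfolding \<xi>_def using ab by (intro Moebius_function_compose) auto
  ultimately have "norm (Moebius_function 0 (h b) (h a)) \<le> norm \<xi>"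
    by (simp add: k_def)
  then show ?thesis
    using \<xi> unfolding poincare_dist_Moebius \<xi>_def by (intro sigma_mono) (auto intro: less_le_trans[of _ 0])
qed

section \<open>Bounds for the squeezing function from single disc embeddings\<close>

lemma disc_embedding_radius_le_1:
  assumes "f \<in> disc_embeddings D p" "0 < r" "ball 0 r \<subseteq> f ` D"
  shows "r \<le> 1"
proof -
  have "ball (0::complex) r \<subseteq> ball 0 1"
    using assms by (auto simp: disc_embeddings_def)
  then show ?thesis using assms(2) by (simp add: ball_subset_ball_iff)
qed

text \<open>By the open mapping theorem the inner supremum runs over a nonempty set, as
  \<open>cSup_least\<close> requires.\<close>

lemma disc_embedding_radius_exists:
  assumes "open D" "p \<in> D" "f \<in> disc_embeddings D p"
  obtains r where "0 < r" "ball 0 r \<subseteq> f ` D"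
proof -
  have "open (f ` D)"
    using assms by (auto simp: disc_embeddings_def intro!: open_mapping_thm3)
  moreover have "0 \<in> f ` D"
    using assms by (force simp: disc_embeddings_def)
  ultimately show ?thesis
    using that by (meson open_contains_ball)
qed

text \<open>The hypothesis \<open>0 \<le> c\<close> covers the default value 0 taken when there is
  no embedding.\<close>

lemma squeezing_function_le:
  assumes "open D" "p \<in> D" "0 \<le> c"
    and "\<And>f r. f \<in> disc_embeddings D p \<Longrightarrow> 0 < r \<Longrightarrow> ball 0 r \<subseteq> f ` D \<Longrightarrow> r \<le> c"
  shows "squeezing_function D p \<le> c"
proof (cases "disc_embeddings D p = {}")
  case False
  have "Sup {r. 0 < r \<and> ball 0 r \<subseteq> f ` D} \<le> c" if f: "f \<in> disc_embeddings D p" for f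
  proof -
    obtain r where "0 < r" "ball 0 r \<subseteq> f ` D"
      by (rule disc_embedding_radius_exists[OF assms(1,2) f])
    then show ?thesis
      using assms(4)[OF f] by (intro cSup_least) auto
  qed
  then show ?thesis
    using False by (auto simp: squeezing_function_def intro!: cSUP_least)
qed (use assms in \<open>auto simp: squeezing_function_def\<close>)

text \<open>Radii never exceed 1, so both nested suprema are over sets bounded above and a single
  admissible radius is a lower bound.\<close>

lemma squeezing_function_ge:
  assumes "open D" "p \<in> D" "f \<in> disc_embeddings D p" "0 < r" "ball 0 r \<subseteq> f ` D"
  shows "r \<le> squeezing_function D p"
proof -
  have bdd: "bdd_above {r. 0 < r \<and> ball 0 r \<subseteq> g ` D}" if "g \<in> disc_embeddings D p" for g
    using disc_embedding_radius_le_1[OF that] by (intro bdd_aboveI[of _ 1]) auto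
  have "Sup {r. 0 < r \<and> ball 0 r \<subseteq> g ` D} \<le> 1" if g: "g \<in> disc_embeddings D p" for g
  proof -
    obtain r where "0 < r" "ball 0 r \<subseteq> g ` D"
      by (rule disc_embedding_radius_exists[OF assms(1,2) g])
    then show ?thesis
      using disc_embedding_radius_le_1[OF g] by (intro cSup_least) auto
  qed
  then have "bdd_above ((\<lambda>g. Sup {r. 0 < r \<and> ball 0 r \<subseteq> g ` D}) ` disc_embeddings D p)"
    by (intro bdd_aboveI[of _ 1]) auto
  moreover have "r \<le> Sup {r. 0 < r \<and> ball 0 r \<subseteq> f ` D}"
    using assms bdd by (intro cSup_upper) auto
  ultimately have "r \<le> (SUP g\<in>disc_embeddings D p. Sup {r. 0 < r \<and> ball 0 r \<subseteq> g ` D})"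
    using assms(3) by (intro cSUP_upper2)
  then show ?thesis
    using assms(3) by (auto simp: squeezing_function_def)
qed

lemma squeezing_function_nonneg:
  assumes "open D" "p \<in> D"
  shows "squeezing_function D p \<ge> 0"
proof (cases "disc_embeddings D p = {}")
  case False
  then show ?thesis
    using squeezing_function_ge[OF assms] disc_embedding_radius_exists[OF assms]
    by (metis all_not_in_conv less_imp_le order_trans)
qed (simp add: squeezing_function_def)

lemma squeezing_function_le_1:
  assumes "open D" "p \<in> D"
  shows "squeezing_function D p \<le> 1"
  using assms disc_embedding_radius_le_1 by (intro squeezing_function_le) auto

subsection \<open>Topology of the sphere\<close>

text \<open>The inverse of \<open>w = 1 / (z - a)\<close>: a chart of the sphere without
  \<open>Some a\<close>, in which that finite point plays the part of infinity. For
  \<open>a = 0\<close> it is \<open>chart_at_infinity\<close>.\<close>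

definition inversion_chart :: "complex \<Rightarrow> complex \<Rightarrow> complex option" where
  "inversion_chart a w = (if w = 0 then None else Some (a + 1 / w))"

lemma chart_at_infinity_eq: "chart_at_infinity = inversion_chart 0"
  by (auto simp: chart_at_infinity_def inversion_chart_def)

lemma inversion_chart_inject [simp]: "inversion_chart a v = inversion_chart a w \<longleftrightarrow> v = w"
  by (auto simp: inversion_chart_def)

lemma inversion_chart_neq [simp]: "inversion_chart a w \<noteq> Some a"
  by (auto simp: inversion_chart_def)

lemma inversion_chart_eq_Some: "inversion_chart a w = Some z \<longleftrightarrow> z \<noteq> a \<and> w = 1 / (z - a)"
  by (auto simp: inversion_chart_def)

lemma range_inversion_chart: "range (inversion_chart a) = - {Some a}"
proof -
  have "x \<in> range (inversion_chart a)" if "x \<noteq> Some a" for x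
  proof (cases x)
    case None
    then show ?thesis by (auto simp: inversion_chart_def image_iff intro!: exI[of _ 0])
  next
    case (Some z)
    then have "x = inversion_chart a (1 / (z - a))"
      using that by (simp add: inversion_chart_def)
    then show ?thesis by blast
  qed
  then show ?thesis by auto
qed

lemma topspace_riemann_sphere [simp]: "topspace riemann_sphere = UNIV"
  by (simp add: riemann_sphere_def flip: UNIV_option_conv)

lemma Hausdorff_riemann_sphere: "Hausdorff_space riemann_sphere"
  unfolding riemann_sphere_def Hausdorff_space_Alexandroff_compactification
  by (simp add: locally_compact_space_euclidean)

text \<open>The plane and one inversion chart cover the sphere, so they determine its topology. The
  point to check is that compactness of the complement of a neighbourhood of \<open>None\<close>
  matches the presence of a chart disc around 0.\<close>

lemma openin_riemann_sphere_iff: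
  "openin riemann_sphere T \<longleftrightarrow> open {z. Some z \<in> T} \<and> open {w. inversion_chart a w \<in> T}"
proof
  have *: "open {w. w \<noteq> 0 \<and> a + 1 / w \<in> U}" if "open U" for U :: "complex set"
  proof -
    have "continuous_on (- {0}) (\<lambda>w. a + 1 / w)"
      by (intro continuous_intros) auto
    then have "open ((\<lambda>w. a + 1 / w) -` U \<inter> - {0})"
      using that by (subst (asm) continuous_on_open_vimage) auto
    also have "(\<lambda>w. a + 1 / w) -` U \<inter> - {0} = {w. w \<noteq> 0 \<and> a + 1 / w \<in> U}"
      by auto
    finally show ?thesis .
  qed
  assume "openin riemann_sphere T"
  then consider U where "open U" "T = Some ` U"
    | C where "compact C" "T = insert None (Some ` (- C))"
    by (auto simp: riemann_sphere_def openin_Alexandroff_compactification Compl_eq_Diff_UNIV)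
  then show "open {z. Some z \<in> T} \<and> open {w. inversion_chart a w \<in> T}"
  proof cases
    case 1
    have "{w. inversion_chart a w \<in> T} = {w. w \<noteq> 0 \<and> a + 1 / w \<in> U}"
      by (auto simp: inversion_chart_def 1)
    moreover have "{z. Some z \<in> T} = U" by (auto simp: 1)
    ultimately show ?thesis using 1 * by simp
  next
    case 2
    have "bounded ((\<lambda>z. z - a) ` C)"
      using 2 by (intro compact_imp_bounded compact_continuous_image continuous_intros)
    then obtain M where M: "M > 0" "\<And>z. z \<in> C \<Longrightarrow> norm (z - a) \<le> M"
      by (auto simp: bounded_pos)
    \<comment> \<open>The map \<open>w = 1 / (z - a)\<close> sends points within distance
      \<open>M\<close> of \<open>a\<close> to points of norm at least \<open>1 / M\<close>, so a
      small chart disc avoids \<open>C\<close>.\<close>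
    have "a + 1 / w \<notin> C" if "w \<noteq> 0" "norm w < 1 / M" for w
      using M(2)[of "a + 1 / w"] that M(1) by (auto simp: norm_divide field_simps)
    then have "{w. inversion_chart a w \<in> T} = ball 0 (1 / M) \<union> {w. w \<noteq> 0 \<and> a + 1 / w \<in> - C}"
      using M(1) by (auto simp: inversion_chart_def 2 split: if_splits)
    moreover have "{z. Some z \<in> T} = - C" by (auto simp: 2)
    ultimately show ?thesis using *[of "- C"] compact_imp_closed[OF 2(1)] by auto
  qed
next
  assume T: "open {z. Some z \<in> T} \<and> open {w. inversion_chart a w \<in> T}"
  show "openin riemann_sphere T"
  proof (cases "None \<in> T")
    case False
    then have "x \<in> T \<longleftrightarrow> x \<in> Some ` {z. Some z \<in> T}" for x
      by (cases x) auto
    then have "T = Some ` {z. Some z \<in> T}" by blast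
    then show ?thesis
      using T unfolding riemann_sphere_def by (metis open_openin openin_Alexandroff_compactification_image_Some)
  next
    case True
    define C where "C = {z. Some z \<notin> T}"
    have "0 \<in> {w. inversion_chart a w \<in> T}" using True by (simp add: inversion_chart_def)
    then obtain d where d: "d > 0" "ball 0 d \<subseteq> {w. inversion_chart a w \<in> T}"
      using T by (meson open_contains_ball)
    \<comment> \<open>Conversely, a chart disc of radius \<open>d\<close> inside the preimage of
      \<open>T\<close> covers every point farther than \<open>1 / d\<close> from \<open>a\<close>,
      which bounds \<open>C\<close>.\<close>
    have "dist a z \<le> 1 / d" if "z \<in> C" for z
    proof (rule ccontr)
      assume far: "\<not> dist a z \<le> 1 / d"
      then have "z \<noteq> a" using d(1) by auto
      moreover have "norm (1 / (z - a)) < d"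
        using far d(1) \<open>z \<noteq> a\<close> by (simp add: norm_divide dist_norm norm_minus_commute field_simps)
      then have "inversion_chart a (1 / (z - a)) \<in> T" using d(2) by auto
      ultimately show False using that by (simp add: C_def inversion_chart_def)
    qed
    then have "bounded C" by (auto simp: bounded_def)
    moreover have "closed C"
      using T unfolding C_def closed_def by (simp add: Collect_neg_eq [symmetric] Compl_eq)
    ultimately have "compact C" by (simp add: compact_eq_bounded_closed)
    moreover have "x \<in> T \<longleftrightarrow> x \<in> insert None (Some ` (- C))" for x
      using True by (cases x) (auto simp: C_def)
    then have "T = insert None (Some ` (- C))" by blast
    ultimately show ?thesis
      using \<open>closed C\<close> unfolding riemann_sphere_def openin_Alexandroff_compactification
      by (intro disjI2 exI[of _ C]) (simp add: Compl_eq_Diff_UNIV)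
  qed
qed

lemma continuous_map_inversion_chart: "continuous_map euclidean riemann_sphere (inversion_chart a)"
  using openin_riemann_sphere_iff[of _ a] by (auto simp: continuous_map_def)

lemma openin_inversion_chart_image:
  assumes "open V"
  shows "openin riemann_sphere (inversion_chart a ` V)"
proof -
  have "{z. Some z \<in> inversion_chart a ` V} = {z. z \<noteq> a \<and> 1 / (z - a) \<in> V}"
    using inversion_chart_eq_Some by (auto simp: image_iff) metis+
  also have "\<dots> = (\<lambda>z. 1 / (z - a)) -` V \<inter> - {a}" by auto
  also have "continuous_on (- {a}) (\<lambda>z. 1 / (z - a))"
    by (intro continuous_intros) auto
  then have "open ((\<lambda>z. 1 / (z - a)) -` V \<inter> - {a})"
    using assms by (subst (asm) continuous_on_open_vimage) auto
  finally have "open {z. Some z \<in> inversion_chart a ` V}" .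
  moreover have "{w. inversion_chart a w \<in> inversion_chart a ` V} = V" by auto
  ultimately show ?thesis using assms openin_riemann_sphere_iff[of _ a] by simp
qed

lemma closedin_inversion_chart_image:
  assumes "compact Q"
  shows "closedin riemann_sphere (inversion_chart a ` Q)"
  using assms Hausdorff_riemann_sphere
  by (intro compactin_imp_closedin image_compactin[OF _ continuous_map_inversion_chart]) auto

lemma closed_vimage_inversion_chart:
  assumes "closedin riemann_sphere S"
  shows "closed (inversion_chart a -` S)"
proof -
  have "openin riemann_sphere (- S)"
    using assms by (simp add: closedin_def Compl_eq_Diff_UNIV)
  then have "open {w. inversion_chart a w \<in> - S}"
    using openin_riemann_sphere_iff[of _ a] by blast
  then show ?thesis by (simp add: closed_def vimage_def Compl_eq)
qed

text \<open>Some disc around \<open>a\<close> misses \<open>S\<close>, and chart points of large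
  norm land in that disc; this supplies boundedness.\<close>

lemma compact_vimage_inversion_chart:
  assumes "closedin riemann_sphere S" "Some a \<notin> S"
  shows "compact (inversion_chart a -` S)"
proof -
  have "openin riemann_sphere (- S)"
    using assms by (simp add: closedin_def Compl_eq_Diff_UNIV)
  then have "open {z. Some z \<in> - S}"
    using openin_riemann_sphere_iff by blast
  then obtain d where d: "d > 0" "ball a d \<subseteq> {z. Some z \<in> - S}"
    using assms(2) by (auto simp: open_contains_ball)
  have "norm w \<le> 1 / d" if "inversion_chart a w \<in> S" for w
  proof (rule ccontr)
    assume "\<not> norm w \<le> 1 / d"
    then have "w \<noteq> 0" "dist a (a + 1 / w) < d"
      using d(1) by (auto simp: dist_norm norm_divide divide_simps mult.commute)
    then show False using that d(2) by (auto simp: inversion_chart_def)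
  qed
  then have "bounded (inversion_chart a -` S)" by (auto simp: bounded_iff)
  then show ?thesis
    using closed_vimage_inversion_chart[OF assms(1)] by (simp add: compact_eq_bounded_closed)
qed

lemma openin_Some_image: "open D \<Longrightarrow> openin riemann_sphere (Some ` D)"
  by (simp add: riemann_sphere_def)

text \<open>Components of a closed set are closed. Finite connectivity enters in the last claim: the
  rest of the complement is a finite union of such components.\<close>

lemma complement_component_split:
  assumes "open D" "finitely_connected D" "E \<in> complement_components D"
  shows "closedin riemann_sphere E" "connectedin riemann_sphere E" "E \<noteq> {}" "E \<inter> Some ` D = {}"
    "closedin riemann_sphere (- (Some ` D \<union> E))"
proof -
  define S where "S = topspace riemann_sphere - Some ` D"
  have S: "closedin riemann_sphere S"
    unfolding S_def using assms(1) openin_Some_image by blast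
  have cl: "closedin riemann_sphere C" if "C \<in> complement_components D" for C
    using that S unfolding complement_components_def S_def[symmetric]
    by (metis closedin_connected_components_of closedin_trans_full)
  show "closedin riemann_sphere E" by (rule cl[OF assms(3)])
  have E: "E \<in> connected_components_of (subtopology riemann_sphere S)"
    using assms(3) by (simp add: complement_components_def S_def)
  show "connectedin riemann_sphere E" "E \<noteq> {}" "E \<inter> Some ` D = {}"
    using connectedin_connected_components_of[OF E] nonempty_connected_components_of[OF E]
    by (auto simp: connectedin_subtopology S_def)
  have "- (Some ` D \<union> E) = \<Union>(complement_components D - {E})"
    using complement_connected_components_of_Union[OF E]
    by (auto simp: complement_components_def S_def)
  then show "closedin riemann_sphere (- (Some ` D \<union> E))"
    using assms(2) cl by (auto simp: finitely_connected_def intro!: closedin_Union)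
qed

lemma eventually_tending_to:
  assumes "openin riemann_sphere T" "E \<subseteq> T" "\<And>z. z \<in> D \<Longrightarrow> Some z \<in> T \<Longrightarrow> P z"
  shows "eventually P (tending_to D E)"
  unfolding tending_to_def
  by (rule eventually_INF1[of T]) (use assms in \<open>auto simp: eventually_principal\<close>)

subsection \<open>Nondegenerate components\<close>

text \<open>Compose \<open>f\<close> with the disc automorphism taking \<open>w = f z\<close> to 0.
  Values omitted by \<open>f\<close> lie in \<open>cball 0 \<rho>\<close>, hence at pseudohyperbolic
  distance at least \<open>r\<close> from \<open>w\<close>, so the new image contains
  \<open>ball 0 r\<close>.\<close>

lemma squeezing_function_lower_bound:
  assumes "open D" "z \<in> D" "f holomorphic_on D" "inj_on f D" "f ` D \<subseteq> ball 0 1"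
    and "0 \<le> \<rho>" "\<rho> < norm (f z)" "ball 0 1 - cball 0 \<rho> \<subseteq> f ` D"
  shows "(norm (f z) - \<rho>) / (1 - \<rho> * norm (f z)) \<le> squeezing_function D z"
proof -
  define w t r where "w = f z" and "t = norm w" and "r = (t - \<rho>) / (1 - \<rho> * t)"
  define g where "g = Moebius_function 0 w \<circ> f"
  have t: "t < 1" "\<rho> < t" and w: "norm w < 1"
    using assms by (auto simp: t_def w_def)
  have pos: "1 - s * t > 0" if "0 \<le> s" "s < 1" for s
    using mult_strict_mono'[of s 1 t 1] that t by (auto simp: t_def)
  have "r > 0"
    using pos[of \<rho>] assms(6) t by (simp add: r_def)
  have inv: "Moebius_function 0 (- w) (Moebius_function 0 w x) = x"
    "Moebius_function 0 w (Moebius_function 0 (- w) x) = x" if "norm x < 1" for x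
    using that w by (auto intro!: Moebius_function_compose)
  have f: "norm (f x) < 1" if "x \<in> D" for x
    using assms(5) that by (auto simp: image_subset_iff)
  have "g holomorphic_on D"
    unfolding g_def using assms w
    by (intro holomorphic_on_compose_gen[of _ _ _ "ball 0 1"] Moebius_function_holomorphic) auto
  moreover have "inj_on g D"
  proof (rule inj_onI)
    fix x y assume xy: "x \<in> D" "y \<in> D" "g x = g y"
    have "f x = Moebius_function 0 (- w) (g x)" "f y = Moebius_function 0 (- w) (g y)"
      unfolding g_def comp_def using inv(1) f xy by auto
    then have "f x = f y" using xy(3) by simp
    then show "x = y" using xy(1,2) assms(4) by (simp add: inj_on_eq_iff)
  qed
  moreover have "g ` D \<subseteq> ball 0 1" "g z = 0"
    using f w by (auto simp: g_def Moebius_function_norm_lt_1 w_def[symmetric] Moebius_function_eq_zero)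
  ultimately have g: "g \<in> disc_embeddings D z"
    by (simp add: disc_embeddings_def)
  have "r < 1"
  proof -
    \<comment> \<open>This product is the denominator of \<open>r\<close> minus its
      numerator.\<close>
    have "0 < (1 - t) * (1 + \<rho>)" using t assms(6) by (intro mult_pos_pos) auto
    then show ?thesis
      using pos[of \<rho>] assms(6) t by (simp add: r_def pos_divide_less_eq algebra_simps)
  qed
  have "ball 0 r \<subseteq> g ` D"
  proof
    fix y :: complex assume "y \<in> ball 0 r"
    then have y: "norm y < r" "norm y < 1" using \<open>r < 1\<close> by auto
    define x where "x = Moebius_function 0 (- w) y"
    have x: "norm x < 1" "Moebius_function 0 w x = y"
      using w y inv(2) by (auto simp: x_def Moebius_function_norm_lt_1)
    have "\<not> norm x \<le> \<rho>"
    proof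
      assume le: "norm x \<le> \<rho>"
      have "t\<^sup>2 \<le> 1" using t(1) by (simp add: t_def power_le_one)
      \<comment> \<open>This is the cross-multiplied difference showing that
        \<open>(t - s) / (1 - s * t)\<close> decreases in \<open>s\<close>.\<close>
      then have "(\<rho> - norm x) * (1 - t\<^sup>2) \<ge> 0"
        using le by (intro mult_nonneg_nonneg) auto
      then have "(t - \<rho>) * (1 - norm x * t) \<le> (t - norm x) * (1 - \<rho> * t)"
        by (simp add: algebra_simps power2_eq_square)
      then have "r \<le> (t - norm x) / (1 - norm x * t)"
        using pos[of \<rho>] pos[of "norm x"] assms(6) t x(1)
        by (simp add: r_def divide_simps)
      also have "\<dots> \<le> norm y"
        using pseudo_hyperbolic_lower_bound[OF x(1) w] x(2) by (simp add: t_def Moebius_function_simple)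
      finally show False using y(1) by simp
    qed
    then obtain v where "v \<in> D" "x = f v" using x(1) assms(8) by force
    then show "y \<in> g ` D" using x(2) by (auto simp: g_def)
  qed
  then show ?thesis
    using squeezing_function_ge[OF assms(1,2) g \<open>r > 0\<close>] by (simp add: r_def t_def w_def)
qed

section \<open>Connectedness and simple connectedness of the inverted complement\<close>

lemma compact_open_set_empty:
  fixes V :: "complex set"
  assumes "compact V" "open V"
  shows "V = {}"
  using assms clopen[of V] not_bounded_UNIV by (auto simp: compact_eq_bounded_closed)

text \<open>In a separation, the connected set \<open>A\<close> misses one of the two pieces. That
  piece is open and equals \<open>K\<close> minus an open set, so it is also compact, hence
  empty.\<close>

lemma connected_Un_compact:
  fixes A K :: "complex set"
  assumes "connected A" "compact K" "open (A \<union> K)"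
  shows "connected (A \<union> K)"
proof -
  have empty: "B \<inter> (A \<union> K) = {}"
    if "open B" "open C" "B \<inter> C \<inter> (A \<union> K) = {}" "A \<union> K \<subseteq> B \<union> C" "B \<inter> A = {}" for B C
  proof (rule compact_open_set_empty)
    have "B \<inter> (A \<union> K) = K - C" using that by blast
    then show "compact (B \<inter> (A \<union> K))"
      using that(2) assms(2) by (simp add: compact_diff)
  qed (use that assms in auto)
  show ?thesis
  proof (rule connectedI)
    fix B C :: "complex set"
    assume BC: "open B" "open C" "B \<inter> (A \<union> K) \<noteq> {}" "C \<inter> (A \<union> K) \<noteq> {}"
      "B \<inter> C \<inter> (A \<union> K) = {}" "A \<union> K \<subseteq> B \<union> C"
    then have "B \<inter> A = {} \<or> C \<inter> A = {}"
      using connectedD[OF assms(1) BC(1,2)] by blast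
    then show False
      using empty[of B C] empty[of C B] BC by blast
  qed
qed

text \<open>A closed curve in \<open>U\<close> winding around a point outside \<open>U\<close> would
  split \<open>E\<close>: the points of \<open>E\<close> with nonzero winding number form a
  relatively open and closed part. It is nonempty, but omits \<open>Some a\<close>, which
  corresponds to infinity in the chart.\<close>

lemma simply_connected_complement:
  assumes "connectedin riemann_sphere E" "Some a \<in> E" "open U" "connected U"
    and U: "U = {w. inversion_chart a w \<notin> E}"
  shows "simply_connected U"
proof -
  have "winding_number g z = 0"
    if g: "path g" "path_image g \<subseteq> U" "pathfinish g = pathstart g" and z: "z \<notin> U" for g z
  proof (rule ccontr)
    assume nz: "winding_number g z \<noteq> 0"
    define V where "V = {w. w \<notin> path_image g \<and> winding_number g w \<noteq> 0}"
    define W where "W = V - U"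
    have "V = (\<Union>k\<in>-{0}. {w. w \<notin> path_image g \<and> winding_number g w = k})"
      by (auto simp: V_def)
    also have "open \<dots>"
      using g open_winding_number_levelsets by blast
    finally have "open V" .
    obtain B where "\<And>w. B \<le> norm w \<Longrightarrow> winding_number g w = 0"
      using winding_number_zero_at_infinity[OF g(1,3)] by blast
    then have "V \<subseteq> ball 0 B"
      by (auto simp: V_def) (meson not_le)
    then have "bounded W"
      by (intro bounded_subset[OF bounded_ball, of W 0 B]) (auto simp: W_def)
    \<comment> \<open>The curve stays in \<open>U\<close>, so outside \<open>U\<close> the winding
      number is defined and \<open>W\<close> is what remains after removing an open level
      set.\<close>
    moreover have "W = - U - {w. w \<notin> path_image g \<and> winding_number g w = 0}"
      using g(2) by (auto simp: W_def V_def)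
    then have "closed W"
      using open_winding_number_levelsets[OF g(1,3)] \<open>open U\<close> by auto
    ultimately have "compact W" by (simp add: compact_eq_bounded_closed)
    \<comment> \<open>Within \<open>E\<close> the image of \<open>V\<close> coincides with that of
      \<open>W\<close>; hence \<open>O1\<close> and \<open>O2\<close> are open sets that cut
      \<open>E\<close> into complementary parts.\<close>
    define O1 O2 where "O1 = inversion_chart a ` V" and "O2 = - (inversion_chart a ` W)"
    have "openin riemann_sphere O1"
      unfolding O1_def by (rule openin_inversion_chart_image[OF \<open>open V\<close>])
    moreover have "openin riemann_sphere O2"
      using closedin_inversion_chart_image[OF \<open>compact W\<close>] unfolding O2_def
      by (simp add: closedin_def Compl_eq_Diff_UNIV)
    moreover have "E \<subseteq> O1 \<union> O2" "O1 \<inter> O2 \<inter> E = {}"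
      by (auto simp: O1_def O2_def W_def U)
    moreover have "inversion_chart a z \<in> O1 \<inter> E"
      using nz z g(2) by (auto simp: O1_def V_def U)
    moreover have "Some a \<in> O2 \<inter> E"
      using assms(2) by (auto simp: O2_def dest: sym)
    ultimately show False
      using assms(1) unfolding connectedin by blast
  qed
  then show ?thesis
    using assms(3,4) by (simp add: simply_connected_eq_winding_number_zero)
qed

text \<open>After inversion the complement of \<open>E\<close> is the image of \<open>D\<close>
  together with a compact set \<open>K\<close> made of the other components. The Riemann map sends
  \<open>K\<close> into some \<open>cball 0 \<rho>\<close>, and its inverse sends closed smaller
  discs to compact sets away from \<open>E\<close>.\<close>

lemma uniformization_of_nondegenerate_component:
  assumes "planar_domain D" "finitely_connected D" "E \<in> complement_components D" "\<not> is_singleton E"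
  obtains f \<rho> where "f holomorphic_on D" "inj_on f D" "f ` D \<subseteq> ball 0 1" "0 \<le> \<rho>" "\<rho> < 1"
    "ball 0 1 - cball 0 \<rho> \<subseteq> f ` D"
    "\<And>r. r < 1 \<Longrightarrow> eventually (\<lambda>z. z \<in> D \<and> r < norm (f z)) (tending_to D E)"
proof -
  have D: "open D" "connected D" "D \<noteq> {}"
    using assms(1) by (auto simp: planar_domain_def)
  note E = complement_component_split[OF D(1) assms(2,3)]
  \<comment> \<open>Of two distinct points at least one is finite and becomes the centre
    \<open>a\<close> of the inversion; the other, \<open>e\<close>, later shows that
    \<open>U\<close> is not the whole plane.\<close>
  obtain e1 e2 where "e1 \<in> E" "e2 \<in> E" "e1 \<noteq> e2"
    using assms(4) E(3) by (metis is_singletonI')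
  then obtain a e where a: "Some a \<in> E" "e \<in> E" "e \<noteq> Some a"
    by (metis option.exhaust)
  define U where "U = {w. inversion_chart a w \<notin> E}"
  define K where "K = inversion_chart a -` (- (Some ` D \<union> E))"
  define i where "i = (\<lambda>z. 1 / (z - a))"
  have "a \<notin> D" using a(1) E(4) by blast
  have chart_i: "inversion_chart a (i z) = Some z" if "z \<in> D" for z
    using that \<open>a \<notin> D\<close> by (auto simp: inversion_chart_def i_def)
  have i_inj: "inj_on i D"
    using chart_i by (metis inj_onI option.inject)
  have i_hol: "i holomorphic_on D"
    unfolding i_def using \<open>a \<notin> D\<close> by (intro holomorphic_intros) auto
  have iU: "i z \<in> U" if "z \<in> D" for z
    using chart_i[OF that] that E(4) by (auto simp: U_def)
  have U_eq: "U = i ` D \<union> K"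
  proof -
    have "w \<in> i ` D" if "inversion_chart a w = Some z" "z \<in> D" for w z
      using that chart_i[of z] by (metis image_eqI inversion_chart_inject)
    then have "U \<subseteq> i ` D \<union> K" by (auto simp: U_def K_def)
    moreover have "K \<subseteq> U" by (auto simp: U_def K_def)
    ultimately show ?thesis using iU by blast
  qed
  have "compact K"
    unfolding K_def using E(5) a(1) by (intro compact_vimage_inversion_chart) auto
  have "U = - (inversion_chart a -` E)" by (auto simp: U_def)
  then have "open U"
    using closed_vimage_inversion_chart[OF E(1)] by auto
  moreover have "connected (i ` D)"
    using D(2) i_hol by (intro connected_continuous_image holomorphic_on_imp_continuous_on)
  ultimately have "connected U"
    using connected_Un_compact \<open>compact K\<close> U_eq by simp
  have "simply_connected U"
    using simply_connected_complement[OF E(2) a(1) \<open>open U\<close> \<open>connected U\<close> U_def] .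
  moreover have "U \<noteq> {}" using iU D(3) by blast
  moreover have "U \<noteq> UNIV"
  proof -
    obtain w where "e = inversion_chart a w"
      using a(3) range_inversion_chart[of a] by auto
    then show ?thesis using a(2) by (auto simp: U_def)
  qed
  ultimately obtain f g where f: "f holomorphic_on U" and g: "g holomorphic_on ball 0 1"
    and fg: "\<And>z. z \<in> U \<Longrightarrow> f z \<in> ball 0 1" "\<And>z. z \<in> U \<Longrightarrow> g (f z) = z"
    and gf: "\<And>z. z \<in> ball 0 1 \<Longrightarrow> g z \<in> U" "\<And>z. z \<in> ball 0 1 \<Longrightarrow> f (g z) = z"
    using simply_connected_eq_biholomorphic_to_disc[OF \<open>open U\<close>] by blast
  have "K \<subseteq> U" using U_eq by blast
  \<comment> \<open>The radius is the maximum of \<open>norm (f k)\<close> over \<open>K\<close>, or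
    0 if \<open>K\<close> is empty.\<close>
  obtain \<rho> where \<rho>: "0 \<le> \<rho>" "\<rho> < 1" "\<And>k. k \<in> K \<Longrightarrow> norm (f k) \<le> \<rho>"
  proof (cases "K = {}")
    case False
    have "continuous_on K (\<lambda>k. norm (f k))"
      using f \<open>K \<subseteq> U\<close> by (intro continuous_on_norm holomorphic_on_imp_continuous_on) (rule holomorphic_on_subset)
    then obtain k where "k \<in> K" "\<And>x. x \<in> K \<Longrightarrow> norm (f x) \<le> norm (f k)"
      using continuous_attains_sup[OF \<open>compact K\<close> False] by blast
    then show ?thesis
      using that[of "norm (f k)"] fg(1)[of k] \<open>K \<subseteq> U\<close> by auto
  qed (use that[of 0] in auto)
  show ?thesis
  proof (rule that[of "f \<circ> i" \<rho>])
    show "f \<circ> i holomorphic_on D"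
      using i_hol f iU by (intro holomorphic_on_compose_gen[of _ _ _ U]) auto
    show "inj_on (f \<circ> i) D"
      using i_inj fg(2) iU by (metis comp_inj_on inj_on_inverseI image_subsetI inj_on_subset)
    show "(f \<circ> i) ` D \<subseteq> ball 0 1"
      using fg(1) iU by auto
    show "ball 0 1 - cball 0 \<rho> \<subseteq> (f \<circ> i) ` D"
    proof
      fix y :: complex assume y: "y \<in> ball 0 1 - cball 0 \<rho>"
      then have "g y \<notin> K" "g y \<in> U" using \<rho>(3)[of "g y"] gf by auto
      then obtain z where "z \<in> D" "g y = i z" using U_eq by blast
      then show "y \<in> (f \<circ> i) ` D" using y gf(2)[of y] by force
    qed
    show "eventually (\<lambda>z. z \<in> D \<and> r < norm ((f \<circ> i) z)) (tending_to D E)" if "r < 1" for r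
    proof (rule eventually_tending_to)
      have sub: "cball (0::complex) r \<subseteq> ball 0 1" using \<open>r < 1\<close> by auto
      then have "compact (g ` cball 0 r)"
        using g by (intro compact_continuous_image holomorphic_on_imp_continuous_on)
          (auto intro: holomorphic_on_subset)
      then show "openin riemann_sphere (- inversion_chart a ` g ` cball 0 r)"
        using closedin_inversion_chart_image[of "g ` cball 0 r" a]
        by (simp add: closedin_def Compl_eq_Diff_UNIV)
      show "E \<subseteq> - inversion_chart a ` g ` cball 0 r"
        using gf(1) sub by (auto simp: U_def)
      show "z \<in> D \<and> r < norm ((f \<circ> i) z)"
        if "z \<in> D" "Some z \<in> - inversion_chart a ` g ` cball 0 r" for z
      proof (rule ccontr)
        assume "\<not> ?thesis"
        then have "f (i z) \<in> cball 0 r" using that by simp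
        then have "i z \<in> g ` cball 0 r"
          using fg(2)[OF iU[OF that(1)]] by (metis image_eqI)
        then have "Some z \<in> inversion_chart a ` g ` cball 0 r"
          using chart_i[OF that(1)] by (metis image_eqI)
        then show False using that(2) by simp
      qed
    qed
  qed (use \<rho> in auto)
qed

lemma squeezing_function_tendsto_1:
  assumes "planar_domain D" "finitely_connected D" "E \<in> complement_components D" "\<not> is_singleton E"
  shows "(squeezing_function D \<longlongrightarrow> 1) (tending_to D E)"
proof -
  obtain f \<rho> where f: "f holomorphic_on D" "inj_on f D" "f ` D \<subseteq> ball 0 1" and \<rho>: "0 \<le> \<rho>" "\<rho> < 1"
    and im: "ball 0 1 - cball 0 \<rho> \<subseteq> f ` D"
    and ev: "\<And>r. r < 1 \<Longrightarrow> eventually (\<lambda>z. z \<in> D \<and> r < norm (f z)) (tending_to D E)"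
    using uniformization_of_nondegenerate_component[OF assms] by blast
  have "open D" using assms(1) by (simp add: planar_domain_def)
  show ?thesis
  proof (rule tendstoI)
    fix e :: real assume "e > 0"
    \<comment> \<open>Chosen so that \<open>1 - t < c\<close> forces
      \<open>2 * (1 - t) / (1 - \<rho>) < e\<close>, where the left side bounds the defect of the
      lower bound from 1.\<close>
    define c where "c = e * (1 - \<rho>) / 2"
    have "c > 0" using \<open>e > 0\<close> \<rho> by (simp add: c_def)
    have "eventually (\<lambda>z. z \<in> D \<and> max \<rho> (1 - c) < norm (f z)) (tending_to D E)"
      using \<open>c > 0\<close> \<rho> by (intro ev) auto
    then show "eventually (\<lambda>z. dist (squeezing_function D z) 1 < e) (tending_to D E)"
    proof eventually_elim
      case (elim z)
      define t where "t = norm (f z)"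
      have t: "\<rho> < t" "1 - c < t" "t < 1" using elim f(3) by (auto simp: t_def)
      have le: "1 - \<rho> \<le> 1 - \<rho> * t"
        using mult_left_mono[of t 1 \<rho>] t \<rho> by simp
      have "1 - (t - \<rho>) / (1 - \<rho> * t) = (1 - t) * (1 + \<rho>) / (1 - \<rho> * t)"
        using le \<rho> by (simp add: divide_simps) (simp add: algebra_simps)
      also have "\<dots> \<le> (1 - t) * 2 / (1 - \<rho>)"
        using t le \<rho> by (intro frac_le mult_left_mono) auto
      also have "\<dots> < c * 2 / (1 - \<rho>)"
        using t \<rho> by (intro divide_strict_right_mono) auto
      also have "\<dots> = e" using \<rho> by (simp add: c_def)
      finally have "1 - e < (t - \<rho>) / (1 - \<rho> * t)" by simp
      also have "\<dots> \<le> squeezing_function D z"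
        using squeezing_function_lower_bound[OF \<open>open D\<close> _ f \<rho>(1) _ im, of z] elim by (simp add: t_def)
      finally show ?case
        using squeezing_function_le_1[OF \<open>open D\<close>, of z] elim by (simp add: dist_real_def)
    qed
  qed
qed

subsection \<open>Punctures\<close>

text \<open>Even at a finite value the definition may supply an expression in the chart at infinity;
  there \<open>g\<close> is nonzero near \<open>z\<close>, so \<open>1 / g\<close> is a finite
  expression on a smaller neighbourhood.\<close>

lemma sphere_holomorphic_local_finite:
  assumes "sphere_holomorphic_on h S" "z \<in> S" "h z = Some c"
  obtains U k where "open U" "z \<in> U" "U \<subseteq> S" "k holomorphic_on U" "\<And>w. w \<in> U \<Longrightarrow> h w = Some (k w)"
proof -
  obtain U g where U: "open U" "z \<in> U" "U \<subseteq> S" and g: "g holomorphic_on U"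
    and h: "(\<forall>w\<in>U. h w = Some (g w)) \<or> (\<forall>w\<in>U. h w = chart_at_infinity (g w))"
    using assms unfolding sphere_holomorphic_on_def by blast
  show ?thesis
  proof (cases "\<forall>w\<in>U. h w = Some (g w)")
    case True
    then show ?thesis using that[OF U g] by blast
  next
    case False
    then have h: "\<And>w. w \<in> U \<Longrightarrow> h w = chart_at_infinity (g w)" using h by blast
    show ?thesis
    proof (rule that[of "U \<inter> g -` (- {0})" "\<lambda>w. 1 / g w"])
      show "open (U \<inter> g -` (- {0}))"
        using U(1) g by (intro continuous_open_preimage holomorphic_on_imp_continuous_on) auto
      show "z \<in> U \<inter> g -` (- {0})"
        using U(2) h[of z] assms(3) by (auto simp: chart_at_infinity_def)
      show "(\<lambda>w. 1 / g w) holomorphic_on U \<inter> g -` (- {0})"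
        using g by (intro holomorphic_intros) (auto intro: holomorphic_on_subset)
    qed (use U h in \<open>auto simp: chart_at_infinity_def\<close>)
  qed
qed

lemma sphere_holomorphic_local_infinite:
  assumes "sphere_holomorphic_on h S" "z \<in> S" "h z = None"
  obtains U k where "open U" "z \<in> U" "U \<subseteq> S" "k holomorphic_on U"
    "\<And>w. w \<in> U \<Longrightarrow> h w = chart_at_infinity (k w)"
proof -
  obtain U g where U: "open U" "z \<in> U" "U \<subseteq> S" "g holomorphic_on U"
    and h: "(\<forall>w\<in>U. h w = Some (g w)) \<or> (\<forall>w\<in>U. h w = chart_at_infinity (g w))"
    using assms unfolding sphere_holomorphic_on_def by blast
  then have "\<forall>w\<in>U. h w = chart_at_infinity (g w)"
    using assms(3) by (metis option.distinct(1))
  then show ?thesis using that[OF U] by blast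
qed

text \<open>These are the two charts used by \<open>sphere_holomorphic_on\<close>; naming them
  together lets a finite puncture and a puncture at infinity be treated by the same
  argument.\<close>

definition standard_chart :: "(complex \<Rightarrow> complex option) \<Rightarrow> bool" where
  "standard_chart \<psi> \<longleftrightarrow> \<psi> = Some \<or> \<psi> = chart_at_infinity"

lemma standard_chart_inject:
  assumes "standard_chart \<psi>"
  shows "\<psi> v = \<psi> w \<longleftrightarrow> v = w"
  using assms by (auto simp: standard_chart_def chart_at_infinity_eq)

lemma open_vimage_standard_chart:
  assumes "standard_chart \<psi>" "openin riemann_sphere T"
  shows "open {w. \<psi> w \<in> T}"
  using assms openin_riemann_sphere_iff[of T 0] by (auto simp: standard_chart_def chart_at_infinity_eq)

lemma openin_standard_chart_image:
  assumes "standard_chart \<psi>" "open V"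
  shows "openin riemann_sphere (\<psi> ` V)"
  using assms openin_Some_image openin_inversion_chart_image[of V 0]
  by (auto simp: standard_chart_def chart_at_infinity_eq)

lemma sphere_holomorphic_on_standard_chart:
  assumes "standard_chart \<psi>" "k holomorphic_on S" "open S"
  shows "sphere_holomorphic_on (\<lambda>z. \<psi> (k z)) S"
  unfolding sphere_holomorphic_on_def
proof (intro ballI exI conjI)
  show "(\<forall>w\<in>S. \<psi> (k w) = Some (k w)) \<or> (\<forall>w\<in>S. \<psi> (k w) = chart_at_infinity (k w))"
    using assms(1) by (auto simp: standard_chart_def)
qed (use assms in auto)

text \<open>The last hypothesis means that \<open>chart_at_infinity\<close> is used only at the
  value \<open>None\<close>, so the two preceding lemmas cover all cases.\<close>

lemma sphere_holomorphic_local_chart: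
  assumes "sphere_holomorphic_on h S" "z \<in> S" "standard_chart \<psi>" "h z = \<psi> c" "\<psi> = Some \<or> c = 0"
  obtains U k where "open U" "z \<in> U" "U \<subseteq> S" "k holomorphic_on U" "k z = c"
    "\<And>w. w \<in> U \<Longrightarrow> h w = \<psi> (k w)"
proof -
  have "\<exists>U k. open U \<and> z \<in> U \<and> U \<subseteq> S \<and> k holomorphic_on U \<and> (\<forall>w\<in>U. h w = \<psi> (k w))"
  proof (cases "\<psi> = Some")
    case True
    then show ?thesis
      using sphere_holomorphic_local_finite[OF assms(1,2), of c] assms(4) by metis
  next
    case False
    then have "\<psi> = chart_at_infinity" "h z = None"
      using assms by (auto simp: standard_chart_def chart_at_infinity_def)
    then show ?thesis
      using sphere_holomorphic_local_infinite[OF assms(1,2)] by metis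
  qed
  then obtain U k where U: "open U" "z \<in> U" "U \<subseteq> S" "k holomorphic_on U" "\<And>w. w \<in> U \<Longrightarrow> h w = \<psi> (k w)"
    by blast
  moreover have "k z = c"
    using U(5)[OF U(2)] assms(4) standard_chart_inject[OF assms(3)] by simp
  ultimately show ?thesis using that by blast
qed

section \<open>Extending disc embeddings over a puncture\<close>

text \<open>Filling in \<open>p\<close> leaves an open set, because the remaining components have
  closed union; its preimage under a chart centred at \<open>p\<close> contains a ball.\<close>

lemma chart_at_puncture:
  assumes "open D" "finitely_connected D" "{p} \<in> complement_components D"
  obtains \<psi> c R where "standard_chart \<psi>" "\<psi> = Some \<or> c = 0" "\<psi> c = p" "R > 0"
    "\<psi> ` ball c R \<subseteq> insert p (Some ` D)"
proof -
  define X where "X = insert p (Some ` D)"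
  have "X = - (- (Some ` D \<union> {p}))" by (auto simp: X_def)
  then have X: "openin riemann_sphere X"
    using complement_component_split(5)[OF assms] by (simp add: closedin_def Compl_eq_Diff_UNIV)
  obtain \<psi> c where \<psi>: "standard_chart \<psi>" "\<psi> = Some \<or> c = 0" "\<psi> c = p"
  proof (cases p)
    case None
    then show ?thesis
      using that[of chart_at_infinity 0] by (simp add: standard_chart_def chart_at_infinity_def)
  next
    case (Some c)
    then show ?thesis using that[of Some c] by (simp add: standard_chart_def)
  qed
  have "c \<in> {w. \<psi> w \<in> X}" using \<psi>(3) by (simp add: X_def)
  then obtain R where "R > 0" "ball c R \<subseteq> {w. \<psi> w \<in> X}"
    using open_vimage_standard_chart[OF \<psi>(1) X] by (meson open_contains_ball)
  then show ?thesis
    using that[OF \<psi>, of R] by (auto simp: X_def)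
qed

text \<open>The extended value is omitted because otherwise two disjoint open sets, one around \<open>p\<close> and one
  around a preimage in \<open>D\<close>, would have overlapping open images.\<close>

lemma extension_over_puncture:
  assumes D: "open D" and p: "p \<notin> Some ` D"
    and \<psi>: "standard_chart \<psi>" "\<psi> = Some \<or> c = 0" "\<psi> c = p"
    and R: "R > 0" "\<psi> ` ball c R \<subseteq> insert p (Some ` D)"
    and f: "f holomorphic_on D" "inj_on f D" "f ` D \<subseteq> ball 0 1"
  obtains g where "g holomorphic_on ball c R" "\<And>w. w \<in> ball c R - {c} \<Longrightarrow> g w = f (the (\<psi> w))"
    "norm (g c) < 1" "g c \<notin> f ` D"
proof -
  define i where "i = (\<lambda>w. the (\<psi> w))"
  have i: "\<psi> w = Some (i w)" "i w \<in> D" if "w \<in> ball c R - {c}" for w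
  proof -
    have "\<psi> w \<noteq> p" using that \<psi> standard_chart_inject by auto
    then have "\<psi> w \<in> Some ` D" using R(2) that by blast
    then show "\<psi> w = Some (i w)" "i w \<in> D" by (auto simp: i_def)
  qed
  have i_inj: "inj_on i (ball c R - {c})"
    using i(1) standard_chart_inject[OF \<psi>(1)] by (metis inj_onI)
  have "i holomorphic_on ball c R - {c}"
  proof (cases "\<psi> = Some")
    case True
    then show ?thesis by (simp add: i_def)
  next
    case False
    then have "\<psi> = chart_at_infinity" "c = 0" using \<psi> by (auto simp: standard_chart_def)
    then have "(\<lambda>w. 1 / w) holomorphic_on ball c R - {c}" "\<And>w. w \<in> ball c R - {c} \<Longrightarrow> i w = 1 / w"
      by (auto simp: i_def chart_at_infinity_def intro!: holomorphic_intros)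
    then show ?thesis by (metis (no_types, lifting) holomorphic_transform)
  qed
  then have "f \<circ> i holomorphic_on ball c R - {c}"
    using f(1) by (rule holomorphic_on_compose_gen) (rule image_subsetI[OF i(2)])
  moreover have "c \<in> interior (ball c R)" using R(1) by simp
  \<comment> \<open>Values of \<open>f\<close> lie in the unit disc, so the singularity at
    \<open>c\<close> is bounded and therefore removable.\<close>
  moreover have "\<exists>B. eventually (\<lambda>w. norm ((f \<circ> i) w) \<le> B) (at c)"
  proof (intro exI[of _ 1] eventually_mono[OF eventually_at_in_open[of "ball c R" c]])
    fix w assume "w \<in> ball c R - {c}"
    then have "f (i w) \<in> ball 0 1" using f(3) i(2) by blast
    then show "norm ((f \<circ> i) w) \<le> 1" by simp
  qed (use R(1) in auto)
  ultimately obtain g where g: "g holomorphic_on ball c R" "\<And>w. w \<in> ball c R - {c} \<Longrightarrow> g w = (f \<circ> i) w"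
    using holomorphic_on_extend_bounded by blast
  \<comment> \<open>Away from \<open>c\<close> the map \<open>g\<close> is the injective
    \<open>f \<circ> i\<close>, so two distinct points off the centre refute constancy. This feeds
    both the maximum principle and the open mapping theorem.\<close>
  have nonconst: "\<not> g constant_on ball c e" if e: "0 < e" "e \<le> R" for e
  proof
    assume "g constant_on ball c e"
    define x y where "x = c + of_real (e / 2)" and "y = c + of_real (e / 3)"
    have xy: "x \<in> ball c e" "y \<in> ball c e" "x \<noteq> c" "y \<noteq> c" "x \<noteq> y"
      using e by (auto simp: x_def y_def dist_norm simp del: of_real_divide)
    then have "g x = g y" using \<open>g constant_on ball c e\<close> by (auto simp: constant_on_def)
    moreover have "x \<in> ball c R - {c}" "y \<in> ball c R - {c}" using xy e by auto
    ultimately have "x = y"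
      using g(2) i(2) i_inj f(2) by (metis comp_apply inj_onD)
    then show False using xy by simp
  qed
  have "norm (g c) < 1"
  proof (rule ccontr)
    assume "\<not> norm (g c) < 1"
    moreover have "norm (g w) < 1" if "w \<in> ball c R - {c}" for w
      using g(2)[OF that] i(2)[OF that] f(3) by auto
    ultimately have "norm (g w) \<le> norm (g c)" if "w \<in> ball c R" for w
      using that by (cases "w = c") force+
    then have "g constant_on ball c R"
      using R(1) g(1) by (intro maximum_modulus_principle[of g "ball c R" "ball c R" c]) auto
    then show False using nonconst[of R] R(1) by simp
  qed
  moreover have "g c \<notin> f ` D"
  proof
    assume "g c \<in> f ` D"
    then obtain q where q: "q \<in> D" "g c = f q" by blast
    then have "p \<noteq> Some q" using p by blast
    then obtain T1 T2 where T: "openin riemann_sphere T1" "openin riemann_sphere T2" "p \<in> T1" "Some q \<in> T2"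
      "disjnt T1 T2"
      using Hausdorff_riemann_sphere unfolding Hausdorff_space_def by (metis UNIV_I topspace_riemann_sphere)
    define N where "N = D \<inter> {x. Some x \<in> T2}"
    have "open N"
      unfolding N_def using D open_vimage_standard_chart[OF _ T(2), of Some] by (auto simp: standard_chart_def)
    have "open (ball c R \<inter> {w. \<psi> w \<in> T1})" "c \<in> ball c R \<inter> {w. \<psi> w \<in> T1}"
      using open_vimage_standard_chart[OF \<psi>(1) T(1)] R(1) \<psi>(3) T(3) by auto
    then obtain e where e: "e > 0" "ball c e \<subseteq> ball c R \<inter> {w. \<psi> w \<in> T1}"
      by (meson open_contains_ball)
    then have "e \<le> R" by (simp add: ball_subset_ball_iff)
    have "open (g ` ball c e)"
      using nonconst[OF e(1) \<open>e \<le> R\<close>] g(1) e(2)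
      by (intro open_mapping_thm[of g "ball c e"]) (auto intro: holomorphic_on_subset)
    moreover have "open (f ` N)"
      using \<open>open N\<close> f(1,2) by (intro open_mapping_thm3) (auto simp: N_def intro: holomorphic_on_subset inj_on_subset)
    ultimately have "open (g ` ball c e \<inter> f ` N)" by (rule open_Int)
    moreover have "g c \<in> g ` ball c e \<inter> f ` N"
    proof
      show "g c \<in> g ` ball c e" using e(1) by (intro imageI) simp
      show "g c \<in> f ` N" using q T(4) by (auto simp: N_def)
    qed
    \<comment> \<open>A common value other than \<open>g c\<close> is wanted, because only at a
      point \<open>x\<close> different from \<open>c\<close> is \<open>g x\<close> a value of
      \<open>f\<close>.\<close>
    ultimately have "g ` ball c e \<inter> f ` N \<noteq> {g c}"
      using not_open_singleton by metis
    then obtain v where v: "v \<in> g ` ball c e" "v \<in> f ` N" "v \<noteq> g c"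
      using \<open>g c \<in> g ` ball c e \<inter> f ` N\<close> by blast
    then obtain x y where x: "x \<in> ball c e" "v = g x" and y: "y \<in> N" "v = f y" by blast
    then have "x \<in> ball c R - {c}" using v(3) e(2) by auto
    then have "f (i x) = f y" "i x \<in> D" "\<psi> x = Some (i x)"
      using g(2) x(2) y(2) i by auto
    then have "\<psi> x = Some y" using f(2) y(1) by (auto simp: N_def dest: inj_onD)
    then show False using x(1) e(2) y(1) T(5) by (auto simp: N_def disjnt_iff)
  qed
  ultimately show ?thesis using that[OF g(1)] g(2) by (auto simp: i_def)
qed

section \<open>Chains of holomorphic discs\<close>

text \<open>The set under the infimum in \<open>kobayashi_dist\<close>, isolated so that
  nonemptiness and lower bounds can be stated about it.\<close>

definition chain_lengths :: "complex option set \<Rightarrow> complex option \<Rightarrow> complex option \<Rightarrow> real set" where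
  "chain_lengths X p q =
     {(\<Sum>i<n. poincare_dist (a i) (b i)) | (n::nat) x f a b.
            x 0 = p \<and> x n = q \<and>
            (\<forall>i<n. sphere_holomorphic_on (f i) (ball 0 1) \<and> f i ` ball 0 1 \<subseteq> X \<and>
                   a i \<in> ball 0 1 \<and> b i \<in> ball 0 1 \<and>
                   f i (a i) = x i \<and> f i (b i) = x (Suc i))}"

lemma kobayashi_dist_eq_Inf: "kobayashi_dist X p q = Inf (chain_lengths X p q)"
  by (simp add: kobayashi_dist_def chain_lengths_def)

lemma chain_lengths_nonneg:
  assumes "l \<in> chain_lengths X p q"
  shows "l \<ge> 0"
  using assms by (auto simp: chain_lengths_def intro!: sum_nonneg poincare_dist_nonneg)

lemma bdd_below_chain_lengths: "bdd_below (chain_lengths X p q)"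
  using chain_lengths_nonneg by (rule bdd_belowI)

text \<open>One link of a chain with its length forgotten; the reflexive transitive closure then
  says that some chain exists.\<close>

definition joined_by_disc :: "complex option set \<Rightarrow> complex option \<Rightarrow> complex option \<Rightarrow> bool" where
  "joined_by_disc X x y \<longleftrightarrow> (\<exists>f a b. sphere_holomorphic_on f (ball 0 1) \<and> f ` ball 0 1 \<subseteq> X \<and>
     a \<in> ball 0 1 \<and> b \<in> ball 0 1 \<and> f a = x \<and> f b = y)"

text \<open>Makes the real infimum meaningful: \<open>cInf_greatest\<close> applies only to a
  nonempty set.\<close>

lemma chain_lengths_nonempty:
  assumes "(joined_by_disc X)\<^sup>*\<^sup>* p q"
  shows "chain_lengths X p q \<noteq> {}"
proof -
  obtain n x where x: "x 0 = p" "x n = q" "\<And>i. i < n \<Longrightarrow> joined_by_disc X (x i) (x (Suc i))"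
    using assms by (auto simp: rtranclp_power relpowp_fun_conv)
  then have "\<forall>i. \<exists>f a b. i < n \<longrightarrow> sphere_holomorphic_on f (ball 0 1) \<and> f ` ball 0 1 \<subseteq> X \<and>
     a \<in> ball 0 1 \<and> b \<in> ball 0 1 \<and> f a = x i \<and> f b = x (Suc i)"
    unfolding joined_by_disc_def by blast
  then obtain f a b where "\<And>i. i < n \<Longrightarrow> sphere_holomorphic_on (f i) (ball 0 1) \<and> f i ` ball 0 1 \<subseteq> X \<and>
     a i \<in> ball 0 1 \<and> b i \<in> ball 0 1 \<and> f i (a i) = x i \<and> f i (b i) = x (Suc i)"
    by metis
  then have "(\<Sum>i<n. poincare_dist (a i) (b i)) \<in> chain_lengths X p q"
    unfolding chain_lengths_def using x(1,2) by blast
  then show ?thesis by blast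
qed

lemma chart_disc:
  assumes "standard_chart \<psi>" "r > 0" "\<psi> ` ball c r \<subseteq> X"
  shows "sphere_holomorphic_on (\<lambda>\<zeta>. \<psi> (c + of_real r * \<zeta>)) (ball 0 1)"
    "(\<lambda>\<zeta>. \<psi> (c + of_real r * \<zeta>)) ` ball 0 1 \<subseteq> X"
    "x \<in> ball c r \<Longrightarrow> (x - c) / of_real r \<in> ball 0 1"
    "\<psi> (c + of_real r * ((x - c) / of_real r)) = \<psi> x"
proof -
  show "sphere_holomorphic_on (\<lambda>\<zeta>. \<psi> (c + of_real r * \<zeta>)) (ball 0 1)"
    by (intro sphere_holomorphic_on_standard_chart assms holomorphic_intros open_ball)
  have "c + of_real r * \<zeta> \<in> ball c r" if "\<zeta> \<in> ball 0 1" for \<zeta>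
    using that assms(2) by (simp add: dist_norm norm_mult)
  then show "(\<lambda>\<zeta>. \<psi> (c + of_real r * \<zeta>)) ` ball 0 1 \<subseteq> X"
    using assms(3) by blast
  show "x \<in> ball c r \<Longrightarrow> (x - c) / of_real r \<in> ball 0 1"
    using assms(2) by (simp add: dist_norm norm_divide norm_minus_commute)
  show "\<psi> (c + of_real r * ((x - c) / of_real r)) = \<psi> x"
    using assms(2) by simp
qed

lemma joined_by_chart_disc:
  assumes "standard_chart \<psi>" "r > 0" "\<psi> ` ball c r \<subseteq> X" "x \<in> ball c r" "y \<in> ball c r"
  shows "joined_by_disc X (\<psi> x) (\<psi> y)"
  unfolding joined_by_disc_def using chart_disc[OF assms(1-3)] assms(4,5) by blast

text \<open>Being joined by a chain is an equivalence relation, and a small disc in \<open>D\<close>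
  joins its centre to each of its points. Its classes are thus open, and a connected
  \<open>D\<close> has only one.\<close>

lemma joined_by_disc_in_domain:
  assumes "open D" "connected D" "Some ` D \<subseteq> X" "x \<in> D" "y \<in> D"
  shows "(joined_by_disc X)\<^sup>*\<^sup>* (Some x) (Some y)"
proof -
  have sym: "symp (joined_by_disc X)"
    by (auto simp: symp_def joined_by_disc_def)
  show ?thesis
  proof (rule connected_equivalence_relation[OF assms(2,4,5)])
    show "(joined_by_disc X)\<^sup>*\<^sup>* (Some v) (Some u)" if "(joined_by_disc X)\<^sup>*\<^sup>* (Some u) (Some v)" for u v
      using that symp_rtranclp[OF sym] by (auto dest: sympD)
    show "\<exists>T. openin (top_of_set D) T \<and> a \<in> T \<and> (\<forall>x\<in>T. (joined_by_disc X)\<^sup>*\<^sup>* (Some a) (Some x))"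
      if "a \<in> D" for a
    proof -
      obtain r where r: "r > 0" "ball a r \<subseteq> D"
        using assms(1) \<open>a \<in> D\<close> by (meson open_contains_ball)
      then have "joined_by_disc X (Some a) (Some v)" if "v \<in> ball a r" for v
        using that assms(3) by (intro joined_by_chart_disc[where c = a and r = r]) (auto simp: standard_chart_def)
      then show ?thesis
        using r assms(1) by (intro exI[of _ "ball a r"]) (auto simp: openin_open_eq)
    qed
  qed auto
qed

text \<open>Composing with \<open>F\<close> sends each link to a self-map of the disc, which does
  not increase Poincare distance. Starting from \<open>F p = 0\<close>, the triangle inequality
  through the origin adds up the links; \<open>hol\<close> expresses holomorphy of \<open>F\<close>
  on a subset of the sphere.\<close>

lemma chain_length_lower_bound:
  assumes F: "F ` X \<subseteq> ball 0 1"
    and hol: "\<And>h. sphere_holomorphic_on h (ball 0 1) \<Longrightarrow> h ` ball 0 1 \<subseteq> X \<Longrightarrow> (F \<circ> h) holomorphic_on ball 0 1"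
    and "F p = 0" "l \<in> chain_lengths X p q"
  shows "sigma (norm (F q)) \<le> l"
proof -
  obtain n x f a b where l: "l = (\<Sum>i<n. poincare_dist (a i) (b i))" and x: "x 0 = p" "x n = q"
    and f: "\<And>i. i < n \<Longrightarrow> sphere_holomorphic_on (f i) (ball 0 1) \<and> f i ` ball 0 1 \<subseteq> X \<and>
                   a i \<in> ball 0 1 \<and> b i \<in> ball 0 1 \<and>
                   f i (a i) = x i \<and> f i (b i) = x (Suc i)"
    using assms(4) unfolding chain_lengths_def by blast
  have "sigma (norm (F (x m))) \<le> (\<Sum>i<m. poincare_dist (a i) (b i))" if "m \<le> n" for m
    using that
  proof (induction m)
    case 0
    then show ?case using x(1) assms(3) by (simp add: sigma_def)
  next
    case (Suc m)
    have fm: "sphere_holomorphic_on (f m) (ball 0 1)" "f m ` ball 0 1 \<subseteq> X" "a m \<in> ball 0 1" "b m \<in> ball 0 1"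
      "f m (a m) = x m" "f m (b m) = x (Suc m)"
      using f[of m] Suc.prems by auto
    have X: "x m \<in> X" "x (Suc m) \<in> X"
      unfolding fm(5,6)[symmetric] using fm(2-4) by (auto simp: image_subset_iff)
    have "poincare_dist ((F \<circ> f m) (a m)) ((F \<circ> f m) (b m)) \<le> poincare_dist (a m) (b m)"
      using fm(2) F by (intro Schwarz_Pick[OF hol[OF fm(1,2)] _ fm(3,4)]) (auto simp: image_subset_iff)
    then have "poincare_dist (F (x m)) (F (x (Suc m))) \<le> poincare_dist (a m) (b m)"
      using fm by simp
    moreover have "sigma (norm (F (x (Suc m)))) \<le> sigma (norm (F (x m))) + poincare_dist (F (x m)) (F (x (Suc m)))"
      using X F by (intro sigma_norm_triangle) auto
    ultimately show ?case using Suc by simp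
  qed
  from this[of n] show ?thesis using x(2) l by simp
qed

text \<open>Holomorphy is local. Near a point mapped to \<open>p\<close> the composite is
  \<open>g\<close> after the expression \<open>k\<close> of \<open>h\<close> in the chart
  \<open>\<psi>\<close>; near any other point it is \<open>f\<close> after a finite expression of
  \<open>h\<close>.\<close>

lemma holomorphic_extension_comp:
  assumes D: "open D" and p: "p \<notin> Some ` D"
    and \<psi>: "standard_chart \<psi>" "\<psi> = Some \<or> c = 0" "\<psi> c = p"
    and R: "R > 0" "\<psi> ` ball c R \<subseteq> insert p (Some ` D)"
    and f: "f holomorphic_on D"
    and g: "g holomorphic_on ball c R" "\<And>w. w \<in> ball c R - {c} \<Longrightarrow> g w = f (the (\<psi> w))"
    and h: "sphere_holomorphic_on h S" "h ` S \<subseteq> insert p (Some ` D)"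
  shows "(\<lambda>x. if x = p then g c else f (the x)) \<circ> h holomorphic_on S" (is "?F \<circ> h holomorphic_on S")
  unfolding holomorphic_on_def
proof
  fix z assume z: "z \<in> S"
  obtain V k f' where V: "open V" "z \<in> V" "k holomorphic_on V" "f' holomorphic_on k ` V"
    "\<And>w. w \<in> V \<Longrightarrow> (?F \<circ> h) w = (f' \<circ> k) w"
  proof (cases "h z = p")
    case True
    then have "h z = \<psi> c" using \<psi>(3) by simp
    then obtain U k where U: "open U" "z \<in> U" "U \<subseteq> S" "k holomorphic_on U" "k z = c"
      "\<And>w. w \<in> U \<Longrightarrow> h w = \<psi> (k w)"
      using sphere_holomorphic_local_chart[OF h(1) z \<psi>(1) _ \<psi>(2)] by blast
    show ?thesis
    proof (rule that[of "U \<inter> k -` ball c R" k g])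
      show "open (U \<inter> k -` ball c R)"
        using U by (intro continuous_open_preimage holomorphic_on_imp_continuous_on) auto
      show "(?F \<circ> h) w = (g \<circ> k) w" if "w \<in> U \<inter> k -` ball c R" for w
        using that U(6)[of w] g(2)[of "k w"] standard_chart_inject[OF \<psi>(1), of "k w" c] \<psi>(3) by auto
    qed (use U R g in \<open>auto intro: holomorphic_on_subset\<close>)
  next
    case False
    then obtain q where q: "q \<in> D" "h z = Some q" using h(2) z by blast
    then obtain U k where U: "open U" "z \<in> U" "U \<subseteq> S" "k holomorphic_on U" "\<And>w. w \<in> U \<Longrightarrow> h w = Some (k w)"
      using sphere_holomorphic_local_finite[OF h(1) z] by blast
    show ?thesis
    proof (rule that[of "U \<inter> k -` D" k f])
      show "open (U \<inter> k -` D)"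
        using U D by (intro continuous_open_preimage holomorphic_on_imp_continuous_on) auto
      show "(?F \<circ> h) w = (f \<circ> k) w" if "w \<in> U \<inter> k -` D" for w
        using that U(5)[of w] p by auto
      show "z \<in> U \<inter> k -` D" using U(2) U(5)[of z] q by auto
    qed (use U f in \<open>auto intro: holomorphic_on_subset\<close>)
  qed
  have "f' \<circ> k holomorphic_on V"
    using V(3,4) by (rule holomorphic_on_compose)
  then have "?F \<circ> h holomorphic_on V"
    using V(5) by (metis (no_types, lifting) holomorphic_transform)
  then show "?F \<circ> h field_differentiable at z within S"
    by (rule field_differentiable_at_within[OF holomorphic_on_imp_differentiable_at[OF _ V(1,2)]])
qed

section \<open>The squeezing function at a puncture\<close>

lemma sigma_inv_mono: "a \<le> b \<Longrightarrow> sigma_inv a \<le> sigma_inv b"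
  by (simp add: sigma_inv_def)

lemma squeezing_function_le_kobayashi:
  assumes "planar_domain D" "finitely_connected D" "{p} \<in> complement_components D" "z \<in> D"
  shows "squeezing_function D z \<le> sigma_inv (kobayashi_dist (insert p (Some ` D)) (Some z) p)"
proof -
  define X where "X = insert p (Some ` D)"
  have D: "open D" "connected D"
    using assms(1) by (auto simp: planar_domain_def)
  have p: "p \<notin> Some ` D"
    using complement_component_split(4)[OF D(1) assms(2,3)] by blast
  obtain \<psi> c R where \<psi>: "standard_chart \<psi>" "\<psi> = Some \<or> c = 0" "\<psi> c = p"
    and R: "R > 0" "\<psi> ` ball c R \<subseteq> insert p (Some ` D)"
    by (rule chart_at_puncture[OF D(1) assms(2,3)])
  \<comment> \<open>A chain inside \<open>D\<close> leads from \<open>z\<close> to a point of the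
    punctured chart ball, and the chart disc supplies the last link to \<open>p\<close>.\<close>
  have "(joined_by_disc X)\<^sup>*\<^sup>* (Some z) p"
  proof -
    define w where "w = c + of_real (R / 2)"
    have w: "w \<in> ball c R" "w \<noteq> c"
      using R(1) by (auto simp: w_def dist_norm simp del: of_real_divide)
    have "\<psi> w \<noteq> p" using w(2) standard_chart_inject[OF \<psi>(1), of w c] \<psi>(3) by simp
    moreover have "\<psi> w \<in> insert p (Some ` D)" using R(2) w(1) by (rule subsetD[OF _ imageI])
    ultimately obtain q where q: "q \<in> D" "\<psi> w = Some q" by blast
    have "joined_by_disc X (\<psi> w) (\<psi> c)"
      using \<psi> R w by (intro joined_by_chart_disc[where c = c and r = R]) (auto simp: X_def)
    moreover have "(joined_by_disc X)\<^sup>*\<^sup>* (Some z) (Some q)"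
      using D assms(4) q(1) by (intro joined_by_disc_in_domain[of D]) (auto simp: X_def)
    ultimately show ?thesis using q(2) \<psi>(3) by (simp add: rtranclp.rtrancl_into_rtrancl)
  qed
  note nonempty = chain_lengths_nonempty[OF this]
  show ?thesis
    unfolding kobayashi_dist_eq_Inf X_def[symmetric]
  proof (rule squeezing_function_le[OF D(1) assms(4)])
    show "0 \<le> sigma_inv (Inf (chain_lengths X (Some z) p))"
      using cInf_greatest[OF nonempty, of 0] chain_lengths_nonneg by (auto simp: sigma_inv_def)
  next
    fix f and r :: real
    assume "f \<in> disc_embeddings D z" and r: "0 < r" "ball 0 r \<subseteq> f ` D"
    then have f: "f holomorphic_on D" "inj_on f D" "f ` D \<subseteq> ball 0 1" "f z = 0"
      by (auto simp: disc_embeddings_def)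
    obtain g where g: "g holomorphic_on ball c R" "\<And>w. w \<in> ball c R - {c} \<Longrightarrow> g w = f (the (\<psi> w))"
      "norm (g c) < 1" "g c \<notin> f ` D"
      using extension_over_puncture[OF D(1) p \<psi> R f(1-3)] by blast
    define F where "F = (\<lambda>x. if x = p then g c else f (the x))"
    have "sigma (norm (g c)) \<le> l" if "l \<in> chain_lengths X (Some z) p" for l
    proof -
      have "F ` X \<subseteq> ball 0 1" using f(3) g(3) by (auto simp: F_def X_def)
      moreover have "F (Some z) = 0" using f(4) p assms(4) by (auto simp: F_def)
      moreover have "F p = g c" by (simp add: F_def)
      ultimately show ?thesis
        using chain_length_lower_bound[of F X "Some z" l p] that
          holomorphic_extension_comp[OF D(1) p \<psi> R f(1) g(1,2), of _ "ball 0 1"]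
        unfolding F_def X_def by simp
    qed
    then have "sigma (norm (g c)) \<le> Inf (chain_lengths X (Some z) p)"
      using nonempty by (intro cInf_greatest)
    then have "norm (g c) \<le> sigma_inv (Inf (chain_lengths X (Some z) p))"
      using sigma_inv_sigma[of "norm (g c)"] g(3) sigma_inv_mono by fastforce
    \<comment> \<open>A larger \<open>r\<close> would put the omitted value \<open>g c\<close>
      inside \<open>ball 0 r\<close>, which lies in the image of \<open>f\<close>.\<close>
    moreover have "r \<le> norm (g c)"
      using r(2) g(4) by (metis in_mono linorder_not_le mem_ball_0)
    ultimately show "r \<le> sigma_inv (Inf (chain_lengths X (Some z) p))" by linarith
  qed
qed

text \<open>A chart disc of radius \<open>R\<close> centred at \<open>p\<close> is a chain with one
  link, so it bounds the Kobayashi distance by \<open>sigma t\<close>, where \<open>t\<close> is the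
  chart distance to \<open>p\<close> divided by \<open>R\<close>. The previous bound then gives
  \<open>squeezing_function D z \<le> t\<close>.\<close>

lemma squeezing_function_tendsto_0:
  assumes "planar_domain D" "finitely_connected D" "{p} \<in> complement_components D"
  shows "(squeezing_function D \<longlongrightarrow> 0) (tending_to D {p})"
proof (rule tendstoI)
  fix e :: real assume "e > 0"
  \<comment> \<open>Capping at 1 keeps the neighbourhood \<open>ball c (d * R)\<close> inside the
    chart ball and ensures \<open>t < 1\<close>, where \<open>sigma_inv\<close> inverts
    \<open>sigma\<close>.\<close>
  define d where "d = min e 1"
  have d: "d > 0" "d \<le> 1" "d \<le> e" using \<open>e > 0\<close> by (auto simp: d_def)
  define X where "X = insert p (Some ` D)"
  have D: "open D" using assms(1) by (simp add: planar_domain_def)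
  obtain \<psi> c R where \<psi>: "standard_chart \<psi>" "\<psi> = Some \<or> c = 0" "\<psi> c = p"
    and R: "R > 0" "\<psi> ` ball c R \<subseteq> X"
    unfolding X_def by (rule chart_at_puncture[OF D assms(2,3)])
  show "eventually (\<lambda>z. dist (squeezing_function D z) 0 < e) (tending_to D {p})"
  proof (rule eventually_tending_to)
    show "openin riemann_sphere (\<psi> ` ball c (d * R))"
      using \<psi>(1) by (intro openin_standard_chart_image) auto
    show "{p} \<subseteq> \<psi> ` ball c (d * R)"
      using \<psi>(3) d R by auto
    show "dist (squeezing_function D z) 0 < e" if z: "z \<in> D" "Some z \<in> \<psi> ` ball c (d * R)" for z
    proof -
      obtain w where w: "w \<in> ball c (d * R)" "Some z = \<psi> w" using z(2) by blast
      define t where "t = norm ((w - c) / of_real R)"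
      have t: "0 \<le> t" "t < d"
        using w(1) R(1) by (auto simp: t_def norm_divide dist_norm norm_minus_commute pos_divide_less_eq)
      have wR: "w \<in> ball c R"
      proof -
        have "d * R \<le> 1 * R" using d(2) R(1) by (intro mult_right_mono) auto
        then show ?thesis using w(1) by simp
      qed
      define h where "h = (\<lambda>\<zeta>. \<psi> (c + of_real R * \<zeta>))"
      note disc = chart_disc[OF \<psi>(1) R, folded h_def]
      have "sphere_holomorphic_on h (ball 0 1) \<and> h ` ball 0 1 \<subseteq> X \<and> (w - c) / of_real R \<in> ball 0 1 \<and>
          (0 :: complex) \<in> ball 0 1 \<and> h ((w - c) / of_real R) = Some z \<and> h 0 = p"
        using disc(1,2) disc(3)[OF wR] R(1) w(2) \<psi>(3) by (simp add: h_def)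
      then have "poincare_dist ((w - c) / of_real R) 0 \<in> chain_lengths X (Some z) p"
        unfolding chain_lengths_def mem_Collect_eq
        by (intro exI[of _ 1] exI[of _ "\<lambda>i. if i = 0 then Some z else p"] exI[of _ "\<lambda>_. h"]
            exI[of _ "\<lambda>_. (w - c) / of_real R"] exI[of _ "\<lambda>_. 0"]) simp
      then have "kobayashi_dist X (Some z) p \<le> sigma t"
        unfolding kobayashi_dist_eq_Inf using bdd_below_chain_lengths
        by (intro cInf_lower2) (auto simp: poincare_dist_def t_def)
      then have "squeezing_function D z \<le> sigma_inv (sigma t)"
        using squeezing_function_le_kobayashi[OF assms z(1)] sigma_inv_mono unfolding X_def
        by (meson order_trans)
      then show ?thesis
        using squeezing_function_nonneg[OF D z(1)] t d by (simp add: sigma_inv_sigma)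
    qed
  qed
qed

theorem theorem5p7:
  fixes D :: "complex set" and E :: "complex option set"
  assumes "planar_domain D"
    and "finitely_connected D"
    and "E \<in> complement_components D"
  shows "(\<not> is_singleton E \<longrightarrow> (squeezing_function D \<longlongrightarrow> 1) (tending_to D E)) \<and>
         (\<forall>p. E = {p} \<longrightarrow>
            (\<forall>z\<in>D. squeezing_function D z
                     \<le> sigma_inv (kobayashi_dist (insert p (Some ` D)) (Some z) p)) \<and>
            (squeezing_function D \<longlongrightarrow> 0) (tending_to D {p}))"
proof (intro conjI impI allI)
  show "(squeezing_function D \<longlongrightarrow> 1) (tending_to D E)" if "\<not> is_singleton E"
    using assms that by (rule squeezing_function_tendsto_1)
next
  fix p assume "E = {p}"
  then have p: "{p} \<in> complement_components D" using assms(3) by simp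
  show "\<forall>z\<in>D. squeezing_function D z
      \<le> sigma_inv (kobayashi_dist (insert p (Some ` D)) (Some z) p)"
    using squeezing_function_le_kobayashi[OF assms(1,2) p] by blast
  show "(squeezing_function D \<longlongrightarrow> 0) (tending_to D {p})"
    using assms(1,2) p by (rule squeezing_function_tendsto_0)
qed

end
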